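(* In the setting described in the context, assume that $f$ satisfies the stated Carath\'eodory condition, that there exists $K\in L^1(I)$, $K\ge0$, with $$|f(t,x)-f(t,y)|\le K(t)\,|x-y|\quad\text{for all }x,y\in\mathbb{R},\ t\in I,$$ and that $$K^1:=\max_{t\in I}\int_0^1|g(t,s)|\,K(s)\,ds<1.$$ Let $u_A$ be a solution of $$L_nu(t)=f(t,u(t))\ \text{ a.e. }t\in I,\qquad B_i(u)=\delta_iC_i(u),\ i=1,\dots,n,$$ and let $u_B$ be a solution of $$L_nu(t)=f(t,u(t))\ \text{ a.e. }t\in I,\qquad B_i(u)=0,\ i=1,\dots,n.$$ For $i,j=1,\dots,n$ put $$K_{ij}^2=\max_{t\in I}|\omega_i(t)|\int_0^1|C_j(g(\cdot,s))|\,K(s)\,ds,\qquad K_{ij}^3=\max_{t\in I}|\omega_i(t)|\int_0^1|C_j(g(\cdot,s))\,f(s,0)|\,ds.$$ Then $$\|u_B-u_A\|_\infty\le\frac{1}{1-K^1}\left(\sum_{i=1}^n\sum_{j=1}^n|\delta_i\,b_{ij}|\,K_{ij}^2\,\|u_A\|_\infty+\sum_{i=1}^n\sum_{j=1}^n|\delta_i\,b_{ij}|\,K_{ij}^3\right).$$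
   Context: $I=[0,1]$, $n\ge1$, $\|\cdot\|_\infty$ is the supremum norm on $C(I)$. $L_nu(t)=u^{(n)}(t)+a_1(t)u^{(n-1)}(t)+\cdots+a_n(t)u(t)$ with $a_1,\dots,a_n\in L^1(I)$; solutions are understood to be in $C^{n-1}(I)$ with $u^{(n-1)}$ absolutely continuous. $B_i(u)=\sum_{j=0}^{n-1}\big(\alpha_j^iu^{(j)}(0)+\beta_j^iu^{(j)}(1)\big)$, $i=1,\dots,n$, with real constants $\alpha_j^i,\beta_j^i$; $C_1,\dots,C_n:C^{n-1}(I)\to\mathbb{R}$ are linear and continuous; $\delta_1,\dots,\delta_n\in\mathbb{R}$. It is assumed that the problem $L_nu=0$ a.e., $B_i(u)=0$ ($i=1,\dots,n$) has only the trivial solution. Then $g$ denotes its Green's function: for each $\sigma\in L^1(I)$ the unique solution of $L_nu=\sigma$ a.e., $B_i(u)=0$ ($i=1,\dots,n$) is $u(t)=\int_0^1g(t,s)\sigma(s)\,ds$. For $i=1,\dots,n$, $\omega_i$ is the unique solution of $L_nu=0$ a.e., $B_i(u)=1$, $B_k(u)=0$ for $k\ne i$. It is also assumed that $\det(\mathrm{Id}-A)\ne0$, where $A=(a_{ij})_{n\times n}$, $a_{ij}=\delta_jC_i(\omega_j)$, and $(b_{ij})_{n\times n}=(\mathrm{Id}-A)^{-1}$. The notation $C_j(g(\cdot,s))$ stands for the (a.e. unique) bounded measurable function of $s$ such that $C_j\big(\int_0^1g(\cdot,s)\sigma(s)\,ds\big)=\int_0^1C_j(g(\cdot,s))\,\sigma(s)\,ds$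 for all $\sigma\in L^1(I)$ (i.e. $C_j$ applied to $g$ in its first variable). Carath\'eodory condition on $f:I\times\mathbb{R}\to\mathbb{R}$: $f(\cdot,x)$ is measurable for all $x\in\mathbb{R}$; $f(t,\cdot)$ is continuous for a.e. $t\in I$; and for every $R>0$ there is $\phi_R$, with $\phi_R\in L^1(I)$ if $n\ge2$ and $\phi_R\in L^\infty(I)$ if $n=1$, such that $|f(t,x)|\le\phi_R(t)$ for all $x\in[-R,R]$ and a.e. $t\in I$. *)

theory Defs
  imports "HOL-Analysis.Analysis"
begin

text \<open>
  Functions on \<open>I = [0,1]\<close> are total functions \<open>real \<Rightarrow> real\<close> of which only the values on \<open>I\<close>
  matter. Derivatives are taken within \<open>I\<close>, hence are one-sided at the end points.
\<close>

abbreviation I01 :: "real set" where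
  "I01 \<equiv> {0..1}"

abbreviation lebI :: "real measure" where
  "lebI \<equiv> lebesgue_on I01"

primrec deriv_I :: "nat \<Rightarrow> (real \<Rightarrow> real) \<Rightarrow> real \<Rightarrow> real" where
  "deriv_I 0 u = u"
| "deriv_I (Suc k) u = (\<lambda>t. vector_derivative (deriv_I k u) (at t within I01))"

definition C_I :: "nat \<Rightarrow> (real \<Rightarrow> real) set" where
  "C_I m = {u. (\<forall>k<m. \<forall>t\<in>I01. deriv_I k u differentiable (at t within I01)) \<and>
               continuous_on I01 (deriv_I m u)}"

definition sup_norm :: "(real \<Rightarrow> real) \<Rightarrow> real" where
  "sup_norm u = (SUP t\<in>I01. \<bar>u t\<bar>)"

definition C_norm :: "nat \<Rightarrow> (real \<Rightarrow> real) \<Rightarrow> real" where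
  "C_norm m u = (\<Sum>k\<le>m. sup_norm (deriv_I k u))"

definition abs_cont_I :: "(real \<Rightarrow> real) \<Rightarrow> bool" where
  "abs_cont_I u \<longleftrightarrow>
     (\<forall>\<epsilon>>0. \<exists>\<delta>>0. \<forall>(N::nat) (x::nat \<Rightarrow> real) (y::nat \<Rightarrow> real).
        (\<forall>k<N. 0 \<le> x k \<and> x k \<le> y k \<and> y k \<le> 1) \<longrightarrow>
        (\<forall>k<N. \<forall>l<N. k \<noteq> l \<longrightarrow> {x k<..<y k} \<inter> {x l<..<y l} = {}) \<longrightarrow>
        (\<Sum>k<N. y k - x k) < \<delta> \<longrightarrow>
        (\<Sum>k<N. \<bar>u (y k) - u (x k)\<bar>) < \<epsilon>)"

definition L_op :: "nat \<Rightarrow> (nat \<Rightarrow> real \<Rightarrow> real) \<Rightarrow> (real \<Rightarrow> real) \<Rightarrow> real \<Rightarrow> real" where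
  "L_op n a u t = deriv_I n u t + (\<Sum>k=1..n. a k t * deriv_I (n - k) u t)"

text \<open>
  \<open>solves n a u \<sigma>\<close> means \<open>L\<^sub>n u = \<sigma>\<close> almost everywhere on \<open>I\<close>. The differentiability of the
  derivative of order \<open>n - 1\<close> almost everywhere follows from its absolute continuity; it is
  recorded because \<^const>\<open>vector_derivative\<close> has an unspecified value where no derivative exists.
\<close>

definition solves ::
  "nat \<Rightarrow> (nat \<Rightarrow> real \<Rightarrow> real) \<Rightarrow> (real \<Rightarrow> real) \<Rightarrow> (real \<Rightarrow> real) \<Rightarrow> bool" where
  "solves n a u \<sigma> \<longleftrightarrow>
     u \<in> C_I (n - 1) \<and> abs_cont_I (deriv_I (n - 1) u) \<and>
     (AE t in lebI. deriv_I (n - 1) u differentiable (at t within I01) \<and> L_op n a u t = \<sigma> t)"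

definition bc :: "nat \<Rightarrow> (nat \<Rightarrow> real) \<Rightarrow> (nat \<Rightarrow> real) \<Rightarrow> (real \<Rightarrow> real) \<Rightarrow> real" where
  "bc n \<alpha> \<beta> u = (\<Sum>j<n. \<alpha> j * deriv_I j u 0 + \<beta> j * deriv_I j u 1)"

text \<open>
  Linear continuous functionals on \<open>C\<^sup>m(I)\<close>. Continuity forces the value to depend on the
  restriction of the argument to \<open>I\<close> only.
\<close>

definition cont_linear_functional :: "nat \<Rightarrow> ((real \<Rightarrow> real) \<Rightarrow> real) \<Rightarrow> bool" where
  "cont_linear_functional m C \<longleftrightarrow>
     (\<forall>u\<in>C_I m. \<forall>v\<in>C_I m. C (\<lambda>t. u t + v t) = C u + C v) \<and>
     (\<forall>u\<in>C_I m. \<forall>c. C (\<lambda>t. c * u t) = c * C u) \<and>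
     (\<forall>u\<in>C_I m. \<forall>\<epsilon>>0. \<exists>\<delta>>0. \<forall>v\<in>C_I m.
        C_norm m (\<lambda>t. v t - u t) < \<delta> \<longrightarrow> \<bar>C v - C u\<bar> < \<epsilon>)"

definition green_function ::
  "nat \<Rightarrow> (nat \<Rightarrow> real \<Rightarrow> real) \<Rightarrow> ('i \<Rightarrow> nat \<Rightarrow> real) \<Rightarrow> ('i \<Rightarrow> nat \<Rightarrow> real) \<Rightarrow>
     (real \<Rightarrow> real \<Rightarrow> real) \<Rightarrow> bool" where
  "green_function n a \<alpha> \<beta> g \<longleftrightarrow>
     (\<forall>\<sigma>. integrable lebI \<sigma> \<longrightarrow>
        (\<forall>t\<in>I01. integrable lebI (\<lambda>s. g t s * \<sigma> s)) \<and>
        solves n a (\<lambda>t. LINT s|lebI. g t s * \<sigma> s) \<sigma> \<and>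
        (\<forall>i. bc n (\<alpha> i) (\<beta> i) (\<lambda>t. LINT s|lebI. g t s * \<sigma> s) = 0))"

text \<open>\<open>c\<close> is (a representative of) the function \<open>s \<mapsto> C(g(\<cdot>,s))\<close>.\<close>

definition applied_to_green ::
  "((real \<Rightarrow> real) \<Rightarrow> real) \<Rightarrow> (real \<Rightarrow> real \<Rightarrow> real) \<Rightarrow> (real \<Rightarrow> real) \<Rightarrow> bool" where
  "applied_to_green C g c \<longleftrightarrow>
     c \<in> borel_measurable lebI \<and> (\<exists>M. \<forall>s\<in>I01. \<bar>c s\<bar> \<le> M) \<and>
     (\<forall>\<sigma>. integrable lebI \<sigma> \<longrightarrow>
        C (\<lambda>t. LINT s|lebI. g t s * \<sigma> s) = (LINT s|lebI. c s * \<sigma> s))"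

definition caratheodory :: "nat \<Rightarrow> (real \<Rightarrow> real \<Rightarrow> real) \<Rightarrow> bool" where
  "caratheodory n f \<longleftrightarrow>
     (\<forall>x. (\<lambda>t. f t x) \<in> borel_measurable lebI) \<and>
     (AE t in lebI. continuous_on UNIV (f t)) \<and>
     (\<forall>R>0. \<exists>\<phi>.
        (if n = 1 then \<phi> \<in> borel_measurable lebI \<and> (\<exists>M. AE t in lebI. \<bar>\<phi> t\<bar> \<le> M)
         else integrable lebI \<phi>) \<and>
        (AE t in lebI. \<forall>x\<in>{-R..R}. \<bar>f t x\<bar> \<le> \<phi> t))"

end

theory Submission
  imports Defs
begin

text \<open>
  Write \<open>\<sigma>A\<close> and \<open>\<sigma>B\<close> for the right-hand sides \<open>f t (u t)\<close> belonging to \<open>u\<^sub>A\<close> and \<open>u\<^sub>B\<close>. By uniqueness,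
  a solution is determined by its right-hand side and its boundary values
  (\<open>green_representation\<close>): on \<open>I01\<close>,
  \<open>u\<^sub>B = \<integral> g \<sigma>B\<close> and \<open>u\<^sub>A = \<integral> g \<sigma>A + \<Sum>i. \<delta> i * c i * \<omega> i\<close> with \<open>c i = C i u\<^sub>A\<close>. Applying \<open>C j\<close> to the
  second identity gives the linear system \<open>c = w + A c\<close> with \<open>w j = \<integral> Cg j \<sigma>A\<close>, so \<open>c = b w\<close>, and

  \<open>u\<^sub>B - u\<^sub>A = \<integral> g (\<sigma>B - \<sigma>A) - \<Sum>i j. \<delta> i * b i j * w j * \<omega> i\<close>.

  By the Lipschitz condition the integral is at most \<open>K1 * sup_norm (u\<^sub>B - u\<^sub>A)\<close>, and comparing
  \<open>f s (u\<^sub>A s)\<close> with \<open>f s 0\<close> bounds \<open>w j\<close> by the integrals in \<open>K2\<close> and \<open>K3\<close>. Since \<open>K1 < 1\<close>, the first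
  term can be absorbed on the left.

  Two points need more than this computation. First, \<open>K1\<close> is a supremum and dominates the
  integrals of \<open>\<bar>g t\<bar> * K\<close> only if these are bounded in \<open>t\<close>, whereas \<open>g\<close> is known only through the
  solutions it produces. The bound comes from a uniform boundedness argument
  (\<open>bdd_above_integral_abs_of_weakly_bounded\<close>, \<open>bdd_above_integral_abs_green\<close>). Second, \<open>\<sigma>A\<close> and \<open>\<sigma>B\<close>
  must be integrable for the Green's function to apply to them, which rests on the measurability
  of the superposition (\<open>integrable_compose_caratheodory\<close>).
\<close>

section \<open>Uniform boundedness of integrals\<close>

lemma integrable_bounded_mult:
  fixes f p :: "'a \<Rightarrow> real"
  assumes f: "integrable M f" and p: "p \<in> borel_measurable M" "\<And>s. s \<in> space M \<Longrightarrow> \<bar>p s\<bar> \<le> B"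
  shows "integrable M (\<lambda>s. p s * f s)"
proof (rule Bochner_Integration.integrable_bound[of M "\<lambda>s. B * \<bar>f s\<bar>"])
  show "integrable M (\<lambda>s. B * \<bar>f s\<bar>)" using f by auto
  have "norm (p s * f s) \<le> norm (B * \<bar>f s\<bar>)" if "s \<in> space M" for s
    using mult_right_mono[OF order.trans[OF p(2)[OF that] abs_ge_self], of "\<bar>f s\<bar>"]
    by (simp add: abs_mult)
  then show "AE s in M. norm (p s * f s) \<le> norm (B * \<bar>f s\<bar>)" by simp
qed (use f p in measurable)

text \<open>
  This is the uniform boundedness principle for functionals \<open>\<phi> \<mapsto> \<integral> h t \<phi>\<close> on bounded functions,
  where the norm of the functional is the integral of \<open>\<bar>h t\<bar>\<close> because it is attained at \<open>sgn (h t)\<close>.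
  The argument is a gliding hump: if the norms were unbounded, choose \<open>\<tau> k\<close> with norm at least
  \<open>4 ^ k\<close> and add up the functions \<open>\<plusminus> 3 ^ -k * sgn (h (\<tau> k))\<close>. Since
  \<open>max \<bar>x + y\<bar> \<bar>x - y\<bar> \<ge> \<bar>y\<bar>\<close>, a suitable sign makes the functional at \<open>\<tau> k\<close> at least
  \<open>3 ^ -k\<close> times its norm on the partial sum, and the remaining terms, of total size
  \<open>3 ^ -k / 2\<close>, can destroy at most half of that. Hence the functionals take values of size at
  least \<open>(4 / 3) ^ k / 2\<close> on the limit, which contradicts the weak bound there.
\<close>

lemma bdd_above_integral_abs_of_weakly_bounded:
  fixes h :: "'t \<Rightarrow> 'a \<Rightarrow> real"
  assumes int: "\<And>t. t \<in> T \<Longrightarrow> integrable M (h t)"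
    and weak: "\<And>\<phi>. \<phi> \<in> borel_measurable M \<Longrightarrow> (\<exists>B. \<forall>s. \<bar>\<phi> s\<bar> \<le> B) \<Longrightarrow>
                 bdd_above ((\<lambda>t. \<bar>LINT s|M. h t s * \<phi> s\<bar>) ` T)"
  shows "bdd_above ((\<lambda>t. LINT s|M. \<bar>h t s\<bar>) ` T)"
proof (rule ccontr)
  assume unbdd: "\<not> ?thesis"
  have "\<exists>t\<in>T. (LINT s|M. \<bar>h t s\<bar>) \<ge> 4 ^ k" for k :: nat
    using unbdd unfolding bdd_above_def by (force simp: not_le intro: less_imp_le)
  then obtain \<tau> where \<tau>: "\<And>k. \<tau> k \<in> T" "\<And>k. (LINT s|M. \<bar>h (\<tau> k) s\<bar>) \<ge> 4 ^ k"
    by metis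
  define N where "N k = (LINT s|M. \<bar>h (\<tau> k) s\<bar>)" for k
  define r :: "nat \<Rightarrow> real" where "r k = (1/3) ^ k" for k
  \<comment> \<open>The sign is chosen so that the new term does not cancel the value already reached.\<close>
  define step where "step k p = (\<lambda>s. p s + (if (LINT s|M. h (\<tau> k) s * p s) \<ge> 0 then 1 else -1)
     * r k * sgn (h (\<tau> k) s))" for k p
  define \<phi> where "\<phi> = rec_nat (\<lambda>s. 0) step"
  have \<phi>0: "\<phi> 0 = (\<lambda>s. 0)" and \<phi>S: "\<phi> (Suc k) = step k (\<phi> k)" for k
    by (simp_all add: \<phi>_def)
  have r0: "r k > 0" for k by (simp add: r_def)
  have hm[measurable]: "h (\<tau> k) \<in> borel_measurable M" for k
    using int[OF \<tau>(1)] by auto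
  have \<phi>m[measurable]: "\<phi> k \<in> borel_measurable M" for k
    by (induction k) (simp_all add: \<phi>0 \<phi>S step_def)
  have incr: "\<bar>\<phi> (Suc k) s - \<phi> k s\<bar> \<le> r k" for k s
    using r0[of k] by (simp add: \<phi>S step_def abs_mult abs_sgn_eq)
  have summ_r: "summable (\<lambda>k. r (k + m))" for m
    by (simp add: r_def power_add summable_mult2)
  have sum_r: "(\<Sum>k. r (k + m)) = 3/2 * r m" for m
    by (simp add: r_def power_add suminf_mult2[symmetric] suminf_geometric)
  have summ: "summable (\<lambda>k. \<phi> (Suc (k + m)) s - \<phi> (k + m) s)" for m s
    by (rule summable_comparison_test'[OF summ_r[of m], of 0]) (use incr in auto)
  define \<psi> where "\<psi> s = (\<Sum>k. \<phi> (Suc k) s - \<phi> k s)" for s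
  have \<psi>m[measurable]: "\<psi> \<in> borel_measurable M"
    unfolding \<psi>_def by measurable
  \<comment> \<open>At \<open>Suc m\<close> this reads \<open>r m / 2\<close>: half of what step \<open>m\<close> has gained.\<close>
  have tail: "\<bar>\<psi> s - \<phi> m s\<bar> \<le> 3/2 * r m" for m s
  proof -
    have "\<psi> s = (\<Sum>k. \<phi> (Suc (k + m)) s - \<phi> (k + m) s) + (\<Sum>k<m. \<phi> (Suc k) s - \<phi> k s)"
      unfolding \<psi>_def using suminf_split_initial_segment[OF summ[of 0 s, simplified], of m] by simp
    also have "(\<Sum>k<m. \<phi> (Suc k) s - \<phi> k s) = \<phi> m s"
      by (subst sum_lessThan_telescope) (simp add: \<phi>0)
    finally have "\<psi> s - \<phi> m s = (\<Sum>k. \<phi> (Suc (k + m)) s - \<phi> (k + m) s)"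
      by simp
    moreover have "norm (\<Sum>k. \<phi> (Suc (k + m)) s - \<phi> (k + m) s) \<le> (\<Sum>k. r (k + m))"
      by (rule norm_suminf_le[OF _ summ_r]) (use incr in auto)
    ultimately show ?thesis by (simp add: sum_r)
  qed
  have \<psi>b: "\<bar>\<psi> s\<bar> \<le> 3/2" for s
    using tail[of s 0] by (simp add: \<phi>0 r_def)
  have \<phi>b: "\<bar>\<phi> k s\<bar> \<le> 3" for k s
  proof -
    have "r k \<le> 1" by (simp add: r_def power_le_one)
    then show ?thesis using tail[of s k] \<psi>b[of s] by linarith
  qed
  have int_prod: "integrable M (\<lambda>s. h (\<tau> k) s * p s)"
    if "p \<in> borel_measurable M" "\<And>s. \<bar>p s\<bar> \<le> B" for k p B
    using integrable_bounded_mult[OF int[OF \<tau>(1)] that] by (simp add: mult.commute)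
  have large: "\<bar>LINT s|M. h (\<tau> k) s * \<phi> (Suc k) s\<bar> \<ge> r k * N k" for k
  proof -
    define I where "I = (LINT s|M. h (\<tau> k) s * \<phi> k s)"
    define e :: real where "e = (if I \<ge> 0 then 1 else -1)"
    have "(LINT s|M. h (\<tau> k) s * \<phi> (Suc k) s)
        = (LINT s|M. h (\<tau> k) s * \<phi> k s + e * r k * \<bar>h (\<tau> k) s\<bar>)"
      by (rule Bochner_Integration.integral_cong)
        (auto simp: \<phi>S step_def e_def I_def algebra_simps abs_sgn)
    also have "\<dots> = I + e * r k * N k"
      using int_prod[OF \<phi>m \<phi>b] int[OF \<tau>(1)]
      by (subst Bochner_Integration.integral_add) (auto simp: I_def N_def)
    finally show ?thesis
      using r0[of k] \<tau>(2)[of k] by (auto simp: e_def N_def[symmetric])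
  qed
  have "\<bar>LINT s|M. h (\<tau> k) s * \<psi> s\<bar> \<ge> (4/3) ^ k / 2" for k
  proof -
    have i: "integrable M (\<lambda>s. h (\<tau> k) s * \<phi> (Suc k) s)" "integrable M (\<lambda>s. h (\<tau> k) s * \<psi> s)"
      by (rule int_prod[OF \<phi>m \<phi>b], rule int_prod[OF \<psi>m \<psi>b])
    have "\<bar>(LINT s|M. h (\<tau> k) s * \<psi> s) - (LINT s|M. h (\<tau> k) s * \<phi> (Suc k) s)\<bar>
       = \<bar>LINT s|M. h (\<tau> k) s * (\<psi> s - \<phi> (Suc k) s)\<bar>"
      using i by (simp add: right_diff_distrib)
    also have "\<dots> \<le> (LINT s|M. r k / 2 * \<bar>h (\<tau> k) s\<bar>)"
    proof (rule order.trans[OF integral_abs_bound integral_mono])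
      show "integrable M (\<lambda>s. \<bar>h (\<tau> k) s * (\<psi> s - \<phi> (Suc k) s)\<bar>)"
        using i by (simp add: right_diff_distrib)
      show "integrable M (\<lambda>s. r k / 2 * \<bar>h (\<tau> k) s\<bar>)" using int[OF \<tau>(1)] by auto
      show "\<bar>h (\<tau> k) s * (\<psi> s - \<phi> (Suc k) s)\<bar> \<le> r k / 2 * \<bar>h (\<tau> k) s\<bar>" for s
        using mult_right_mono[OF tail[of s "Suc k"], of "\<bar>h (\<tau> k) s\<bar>"]
        by (simp add: abs_mult mult.commute r_def)
    qed
    also have "\<dots> = r k * N k / 2" by (simp add: N_def)
    finally have "\<bar>LINT s|M. h (\<tau> k) s * \<psi> s\<bar> \<ge> r k * N k / 2" using large[of k] by linarith
    moreover have "r k * N k \<ge> r k * 4 ^ k"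
      using \<tau>(2)[of k] r0[of k] by (simp add: N_def)
    moreover have "r k * 4 ^ k = (4/3) ^ k" by (simp add: r_def power_divide)
    ultimately show ?thesis by linarith
  qed
  moreover obtain B where "\<And>t. t \<in> T \<Longrightarrow> \<bar>LINT s|M. h t s * \<psi> s\<bar> \<le> B"
    using weak[OF \<psi>m] \<psi>b unfolding bdd_above_def by fastforce
  ultimately have "(4/3) ^ k \<le> 2 * B" for k :: nat
    using \<tau>(1)[of k] by (metis divide_le_eq_numeral1(1) mult.commute order.trans)
  moreover obtain k where "(4/3) ^ k > 2 * B"
    using real_arch_pow[of "4/3" "2 * B"] by auto
  ultimately show False by (meson not_le)
qed

section \<open>Linearity of derivatives, equation and functionals\<close>

text \<open>
  Derivatives are taken within \<open>I01\<close>, so values elsewhere do not enter. This allows identities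
  that hold only on \<open>I01\<close> to be differentiated.
\<close>

lemma deriv_I_cong:
  assumes "\<And>t. t \<in> I01 \<Longrightarrow> u t = v t" "t \<in> I01"
  shows "deriv_I k u t = deriv_I k v t"
  using assms(2)
proof (induction k arbitrary: t)
  case (Suc k)
  then have "(deriv_I k u has_vector_derivative D) (at t within I01) \<longleftrightarrow>
             (deriv_I k v has_vector_derivative D) (at t within I01)" for D
    by (metis has_vector_derivative_transform)
  then show ?case by (simp add: vector_derivative_def)
qed (use assms in simp)

lemma derivative_within_I_lincomb:
  fixes p q w :: "real \<Rightarrow> real"
  assumes "t \<in> I01" "p differentiable (at t within I01)" "q differentiable (at t within I01)"
    and "\<And>s. s \<in> I01 \<Longrightarrow> w s = p s + c * q s"
  shows "w differentiable (at t within I01)" (is ?diff)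
    and "vector_derivative w (at t within I01)
       = vector_derivative p (at t within I01) + c * vector_derivative q (at t within I01)" (is ?eq)
proof -
  have "((\<lambda>s. p s + c * q s) has_vector_derivative
      vector_derivative p (at t within I01) + c * vector_derivative q (at t within I01)) (at t within I01)"
    using assms(2,3)
    by (intro has_vector_derivative_add has_vector_derivative_mult_right)
      (simp_all add: vector_derivative_works)
  then have w: "(w has_vector_derivative
      vector_derivative p (at t within I01) + c * vector_derivative q (at t within I01)) (at t within I01)"
    by (rule has_vector_derivative_transform[OF assms(1), rotated]) (use assms(4) in auto)
  then show ?diff by (rule differentiableI_vector)
  show ?eq using w assms(1) by (intro vector_derivative_within_closed_interval) auto
qed

lemma deriv_I_lincomb:
  assumes "u \<in> C_I m" "v \<in> C_I m" "k \<le> m" "t \<in> I01"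
  shows "deriv_I k (\<lambda>t. u t + c * v t) t = deriv_I k u t + c * deriv_I k v t"
  using assms(3,4)
proof (induction k arbitrary: t)
  case (Suc k)
  then show ?case
    using derivative_within_I_lincomb(2)[of t "deriv_I k u" "deriv_I k v"] assms(1,2)
    by (simp add: C_I_def)
qed simp

lemma C_I_lincomb:
  assumes "u \<in> C_I m" "v \<in> C_I m"
  shows "(\<lambda>t. u t + c * v t) \<in> C_I m"
proof -
  have "continuous_on I01 (\<lambda>t. deriv_I m u t + c * deriv_I m v t)"
    using assms by (intro continuous_intros) (simp_all add: C_I_def)
  then have "continuous_on I01 (deriv_I m (\<lambda>t. u t + c * v t))"
    by (rule continuous_on_eq) (use deriv_I_lincomb[OF assms order.refl] in simp)
  moreover have "deriv_I k (\<lambda>t. u t + c * v t) differentiable (at t within I01)"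
    if "k < m" "t \<in> I01" for k t
    by (rule derivative_within_I_lincomb(1)[of t "deriv_I k u" "deriv_I k v" _ c])
      (use assms that deriv_I_lincomb[OF assms, of k] in \<open>simp_all add: C_I_def\<close>)
  ultimately show ?thesis by (simp add: C_I_def)
qed

lemma C_I_imp_continuous_on:
  assumes "u \<in> C_I m"
  shows "continuous_on I01 u"
proof (cases m)
  case (Suc k)
  then have "u differentiable (at t within I01)" if "t \<in> I01" for t
    using assms that by (auto simp: C_I_def)
  then show ?thesis
    by (auto simp: continuous_on_eq_continuous_within intro: differentiable_imp_continuous_within)
qed (use assms in \<open>simp add: C_I_def\<close>)

lemma bc_lincomb:
  assumes "u \<in> C_I (n - 1)" "v \<in> C_I (n - 1)"
  shows "bc n \<alpha> \<beta> (\<lambda>t. u t + c * v t) = bc n \<alpha> \<beta> u + c * bc n \<alpha> \<beta> v"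
proof -
  have "deriv_I j (\<lambda>t. u t + c * v t) t = deriv_I j u t + c * deriv_I j v t"
    if "j < n" "t \<in> I01" for j t
    using that by (intro deriv_I_lincomb[OF assms]) auto
  then show ?thesis
    by (simp add: bc_def sum_distrib_left sum.distrib[symmetric] algebra_simps)
qed

text \<open>
  A tolerance \<open>\<epsilon>\<close> is split into \<open>\<epsilon> / 2\<close> for \<open>u\<close> and \<open>\<epsilon> / (2 * (\<bar>c\<bar> + 1))\<close> for \<open>v\<close>; the summand \<open>1\<close>
  covers \<open>c = 0\<close>.
\<close>

lemma abs_cont_I_lincomb:
  assumes u: "abs_cont_I u" and v: "abs_cont_I v"
    and w: "\<And>t. t \<in> I01 \<Longrightarrow> w t = u t + c * v t"
  shows "abs_cont_I w"
proof -
  define P where "P z \<epsilon> d \<longleftrightarrow> (\<forall>(N::nat) (x::nat \<Rightarrow> real) (y::nat \<Rightarrow> real).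
        (\<forall>k<N. 0 \<le> x k \<and> x k \<le> y k \<and> y k \<le> 1) \<longrightarrow>
        (\<forall>k<N. \<forall>l<N. k \<noteq> l \<longrightarrow> {x k<..<y k} \<inter> {x l<..<y l} = {}) \<longrightarrow>
        (\<Sum>k<N. y k - x k) < d \<longrightarrow>
        (\<Sum>k<N. \<bar>z (y k) - z (x k)\<bar>) < \<epsilon>)" for z :: "real \<Rightarrow> real" and \<epsilon> d :: real
  have ac: "abs_cont_I z \<longleftrightarrow> (\<forall>\<epsilon>>0. \<exists>d>0. P z \<epsilon> d)" for z
    by (simp only: abs_cont_I_def P_def)
  have "\<exists>d>0. P w \<epsilon> d" if \<epsilon>: "\<epsilon> > 0" for \<epsilon>
  proof -
    define \<eta> where "\<eta> = \<epsilon> / (2 * (\<bar>c\<bar> + 1))"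
    have \<eta>: "\<eta> > 0" "\<bar>c\<bar> * \<eta> \<le> \<epsilon> / 2"
      using \<epsilon> by (auto simp: \<eta>_def field_simps)
    obtain d where d: "d > 0" "P u (\<epsilon> / 2) d"
      using u \<epsilon> unfolding ac by (meson half_gt_zero)
    obtain e where e: "e > 0" "P v \<eta> e"
      using v \<eta> unfolding ac by meson
    have "P w \<epsilon> (min d e)"
      unfolding P_def
    proof (intro allI impI)
      fix N :: nat and x y :: "nat \<Rightarrow> real"
      assume xy: "\<forall>k<N. 0 \<le> x k \<and> x k \<le> y k \<and> y k \<le> 1"
        and disj: "\<forall>k<N. \<forall>l<N. k \<noteq> l \<longrightarrow> {x k<..<y k} \<inter> {x l<..<y l} = {}"
        and small: "(\<Sum>k<N. y k - x k) < min d e"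
      have "\<bar>w (y k) - w (x k)\<bar> \<le> \<bar>u (y k) - u (x k)\<bar> + \<bar>c\<bar> * \<bar>v (y k) - v (x k)\<bar>"
        if "k < N" for k
      proof -
        have "x k \<in> I01" "y k \<in> I01" using xy that by force+
        then have "w (y k) - w (x k) = (u (y k) - u (x k)) + c * (v (y k) - v (x k))"
          by (simp add: w algebra_simps)
        then show ?thesis by (metis abs_mult abs_triangle_ineq)
      qed
      then have "(\<Sum>k<N. \<bar>w (y k) - w (x k)\<bar>)
          \<le> (\<Sum>k<N. \<bar>u (y k) - u (x k)\<bar> + \<bar>c\<bar> * \<bar>v (y k) - v (x k)\<bar>)"
        by (intro sum_mono) auto
      then have le: "(\<Sum>k<N. \<bar>w (y k) - w (x k)\<bar>)
          \<le> (\<Sum>k<N. \<bar>u (y k) - u (x k)\<bar>) + \<bar>c\<bar> * (\<Sum>k<N. \<bar>v (y k) - v (x k)\<bar>)"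
        by (simp only: sum.distrib sum_distrib_left)
      have du: "(\<Sum>k<N. \<bar>u (y k) - u (x k)\<bar>) < \<epsilon> / 2"
        using d(2)[unfolded P_def, rule_format, of N x y] xy disj small by simp
      have "(\<Sum>k<N. \<bar>v (y k) - v (x k)\<bar>) < \<eta>"
        using e(2)[unfolded P_def, rule_format, of N x y] xy disj small by simp
      then have "\<bar>c\<bar> * (\<Sum>k<N. \<bar>v (y k) - v (x k)\<bar>) \<le> \<bar>c\<bar> * \<eta>"
        by (intro mult_left_mono) auto
      then show "(\<Sum>k<N. \<bar>w (y k) - w (x k)\<bar>) < \<epsilon>" using le du \<eta>(2) by linarith
    qed
    then show ?thesis using d(1) e(1) by (intro exI[of _ "min d e"]) auto
  qed
  then show ?thesis by (simp add: ac)
qed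

text \<open>
  Below order \<open>n\<close> the derivatives are linear at every point of \<open>I01\<close>. At order \<open>n\<close> this holds
  only where the derivatives of order \<open>n - 1\<close> of both functions are differentiable, which is
  almost everywhere.
\<close>

lemma solves_lincomb:
  assumes n: "n \<ge> 1" and u: "solves n a u \<sigma>" and v: "solves n a v \<tau>"
  shows "solves n a (\<lambda>t. u t + c * v t) (\<lambda>t. \<sigma> t + c * \<tau> t)"
proof -
  let ?w = "\<lambda>t. u t + c * v t"
  have uC: "u \<in> C_I (n - 1)" and vC: "v \<in> C_I (n - 1)" using u v by (auto simp: solves_def)
  have lin: "deriv_I k ?w t = deriv_I k u t + c * deriv_I k v t" if "k < n" "t \<in> I01" for k t
    using that by (intro deriv_I_lincomb[OF uC vC]) auto
  have "AE t in lebI. deriv_I (n - 1) u differentiable (at t within I01) \<and> L_op n a u t = \<sigma> t"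
    using u by (simp add: solves_def)
  moreover have "AE t in lebI. deriv_I (n - 1) v differentiable (at t within I01) \<and> L_op n a v t = \<tau> t"
    using v by (simp add: solves_def)
  ultimately have "AE t in lebI. deriv_I (n - 1) ?w differentiable (at t within I01) \<and>
      L_op n a ?w t = \<sigma> t + c * \<tau> t"
  proof (rule AE_mp[OF AE_conjI], intro AE_I2 impI, elim conjE)
    fix t assume t: "t \<in> space lebI"
      and du: "deriv_I (n - 1) u differentiable (at t within I01)" "L_op n a u t = \<sigma> t"
      and dv: "deriv_I (n - 1) v differentiable (at t within I01)" "L_op n a v t = \<tau> t"
    have tI: "t \<in> I01" using t by simp
    note D = derivative_within_I_lincomb[OF tI du(1) dv(1), of "deriv_I (n - 1) ?w" c]
    have top: "deriv_I n ?w t = deriv_I n u t + c * deriv_I n v t"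
      using D(2) lin n by (cases n) auto
    have "L_op n a ?w t = L_op n a u t + c * L_op n a v t"
      using lin[OF _ tI] n
      by (simp add: L_op_def top sum_distrib_left sum.distrib[symmetric] algebra_simps)
    then show "deriv_I (n - 1) ?w differentiable (at t within I01) \<and> L_op n a ?w t = \<sigma> t + c * \<tau> t"
      using D(1) lin n du dv by simp
  qed
  moreover have "abs_cont_I (deriv_I (n - 1) ?w)"
    by (rule abs_cont_I_lincomb[of "deriv_I (n - 1) u" "deriv_I (n - 1) v"])
      (use u v n lin in \<open>auto simp: solves_def\<close>)
  ultimately show ?thesis using C_I_lincomb[OF uC vC] by (simp add: solves_def)
qed

lemma cont_linear_functional_lincomb:
  assumes "cont_linear_functional m C" "u \<in> C_I m" "v \<in> C_I m"
  shows "C (\<lambda>t. u t + c * v t) = C u + c * C v"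
proof -
  \<comment> \<open>The multiple is written as \<open>v + (c - 1) * v\<close>, which avoids treating the zero function.\<close>
  have "(\<lambda>t. c * v t) \<in> C_I m"
    using C_I_lincomb[OF assms(3,3), of "c - 1"] by (simp add: algebra_simps)
  then show ?thesis using assms by (simp add: cont_linear_functional_def)
qed

text \<open>
  If \<open>u\<close> and \<open>v\<close> agree on \<open>I01\<close>, their distance in \<open>C_norm\<close> is zero, so by continuity \<open>C u\<close> and
  \<open>C v\<close> differ by less than every positive number.
\<close>

lemma cont_linear_functional_cong:
  assumes C: "cont_linear_functional m C" and u: "u \<in> C_I m" and v: "v \<in> C_I m"
    and eq: "\<And>t. t \<in> I01 \<Longrightarrow> u t = v t"
  shows "C u = C v"
proof (rule ccontr)
  assume "C u \<noteq> C v"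
  then have "\<bar>C v - C u\<bar> > 0" by simp
  with C u obtain \<delta> where "\<delta> > 0"
    and *: "\<And>v'. v' \<in> C_I m \<Longrightarrow> C_norm m (\<lambda>t. v' t - u t) < \<delta> \<Longrightarrow> \<bar>C v' - C u\<bar> < \<bar>C v - C u\<bar>"
    unfolding cont_linear_functional_def by meson
  have "deriv_I k (\<lambda>t. v t - u t) t = 0" if "k \<le> m" "t \<in> I01" for k t
  proof -
    have "deriv_I k (\<lambda>t. v t - u t) t = deriv_I k (\<lambda>t. u t + (-1) * u t) t"
      by (rule deriv_I_cong) (use eq that in auto)
    then show ?thesis using deriv_I_lincomb[OF u u that, of "-1"] by simp
  qed
  then have "C_norm m (\<lambda>t. v t - u t) = 0"
    by (simp add: C_norm_def sup_norm_def)
  with * v \<open>\<delta> > 0\<close> show False by force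
qed

lemma C_I_sum:
  assumes "finite S" "v \<in> C_I m" "\<And>i. \<omega> i \<in> C_I m"
  shows "(\<lambda>t. v t + (\<Sum>i\<in>S. d i * \<omega> i t)) \<in> C_I m"
  using assms(1)
proof (induction S rule: finite_induct)
  case (insert i S)
  then show ?case
    using C_I_lincomb[OF insert.IH assms(3)[of i], of "d i"] by (simp add: add_ac)
qed (simp add: assms)

text \<open>
  Stated for an abstract \<open>F\<close> so that it covers both the boundary forms \<open>bc\<close> and the functionals
  \<open>C j\<close>.
\<close>

lemma linear_on_C_I_sum:
  fixes F :: "(real \<Rightarrow> real) \<Rightarrow> real"
  assumes F: "\<And>u v c. u \<in> C_I m \<Longrightarrow> v \<in> C_I m \<Longrightarrow> F (\<lambda>t. u t + c * v t) = F u + c * F v"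
    and "finite S" "v \<in> C_I m" "\<And>i. \<omega> i \<in> C_I m"
  shows "F (\<lambda>t. v t + (\<Sum>i\<in>S. d i * \<omega> i t)) = F v + (\<Sum>i\<in>S. d i * F (\<omega> i))"
  using assms(2)
proof (induction S rule: finite_induct)
  case (insert i S)
  then show ?case
    using F[OF C_I_sum[of S v m \<omega> d] assms(4)[of i], of "d i"] assms(3,4) by (simp add: add_ac)
qed simp

lemma solves_sum:
  assumes "n \<ge> 1" "finite S" "solves n a v \<sigma>" "\<And>i. solves n a (\<omega> i) (\<lambda>t. 0)"
  shows "solves n a (\<lambda>t. v t + (\<Sum>i\<in>S. d i * \<omega> i t)) \<sigma>"
  using assms(2)
proof (induction S rule: finite_induct)
  case (insert i S)
  then show ?case
    using solves_lincomb[OF assms(1) insert.IH assms(4)[of i], of "d i"] by (simp add: add_ac)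
qed (simp add: assms)

section \<open>Continuous functions and the supremum norm\<close>

lemma bdd_above_abs_continuous:
  fixes u :: "real \<Rightarrow> real"
  assumes "continuous_on I01 u"
  shows "bdd_above ((\<lambda>t. \<bar>u t\<bar>) ` I01)"
proof -
  have "compact ((\<lambda>t. \<bar>u t\<bar>) ` I01)"
    by (rule compact_continuous_image[OF continuous_on_rabs[OF assms]]) simp
  then show ?thesis by (rule bounded_imp_bdd_above[OF compact_imp_bounded])
qed

lemma abs_le_sup_norm:
  assumes "continuous_on I01 u" "t \<in> I01"
  shows "\<bar>u t\<bar> \<le> sup_norm u"
  unfolding sup_norm_def by (rule cSUP_upper[OF assms(2) bdd_above_abs_continuous[OF assms(1)]])

section \<open>Superposition with a Caratheodory function\<close>

text \<open>
  Rounding \<open>u\<close> down to a multiple of \<open>1 / (k + 1)\<close> leaves only countably many values, so the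
  composition with the rounded function is measurable; continuity of \<open>f t\<close> carries this over to
  the limit.
\<close>

lemma borel_measurable_compose_continuous:
  fixes f :: "'a \<Rightarrow> real \<Rightarrow> real"
  assumes f: "\<And>x. (\<lambda>t. f t x) \<in> borel_measurable M"
    and cont: "\<And>t. t \<in> space M \<Longrightarrow> continuous_on UNIV (f t)"
    and u[measurable]: "u \<in> borel_measurable M"
  shows "(\<lambda>t. f t (u t)) \<in> borel_measurable M"
proof -
  define v :: "nat \<Rightarrow> 'a \<Rightarrow> real" where "v k t = of_int \<lfloor>u t * (k + 1)\<rfloor> / (k + 1)" for k t
  have "\<bar>v k t - u t\<bar> \<le> inverse (real (Suc k))" for k t
  proof -
    define x where "x = u t * (k + 1)"
    have "v k t - u t = (of_int \<lfloor>x\<rfloor> - x) * inverse (real (Suc k))"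
      by (simp add: v_def x_def divide_inverse left_diff_distrib mult.assoc add.commute
               del: of_nat_Suc add: of_nat_Suc[symmetric])
    moreover have "\<bar>of_int \<lfloor>x\<rfloor> - x\<bar> \<le> 1" by linarith
    ultimately show ?thesis by (simp add: abs_mult mult_left_le_one_le del: of_nat_Suc)
  qed
  then have "(\<lambda>k. v k t - u t) \<longlonglongrightarrow> 0" for t
    by (intro Lim_null_comparison[OF _ LIMSEQ_inverse_real_of_nat]) auto
  then have lim: "(\<lambda>k. v k t) \<longlonglongrightarrow> u t" for t
    by (rule LIM_zero_cancel)
  show ?thesis
  proof (rule borel_measurable_LIMSEQ_real)
    show "(\<lambda>k. f t (v k t)) \<longlonglongrightarrow> f t (u t)" if "t \<in> space M" for t
      using cont[OF that] lim[of t] continuous_on_tendsto_compose[of UNIV "f t"] by auto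
    show "(\<lambda>t. f t (v k t)) \<in> borel_measurable M" for k
      unfolding v_def
    proof (rule measurable_compose_countable[where f = "\<lambda>i t. f t (of_int i / (real k + 1))"
          and g = "\<lambda>t. \<lfloor>u t * (real k + 1)\<rfloor>"])
      show "(\<lambda>t. f t (of_int i / (real k + 1))) \<in> borel_measurable M" for i
        by (rule f)
      show "(\<lambda>t. \<lfloor>u t * (real k + 1)\<rfloor>) \<in> measurable M (count_space UNIV)"
        by measurable
    qed
  qed
qed

text \<open>
  The Lipschitz condition bounds \<open>\<bar>f t (u t)\<bar>\<close> by \<open>\<bar>f t 0\<bar> + K t * sup_norm u\<close>, and the
  Caratheodory bound on \<open>[-1, 1]\<close> controls \<open>f t 0\<close>.
\<close>

lemma integrable_compose_caratheodory:
  assumes f: "caratheodory n f"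
    and K: "integrable lebI K" "\<And>t. t \<in> I01 \<Longrightarrow> K t \<ge> 0"
    and lipschitz: "\<And>t x y. t \<in> I01 \<Longrightarrow> \<bar>f t x - f t y\<bar> \<le> K t * \<bar>x - y\<bar>"
    and u: "continuous_on I01 u"
  shows "integrable lebI (\<lambda>t. f t (u t))"
proof -
  have fm: "(\<lambda>t. f t x) \<in> borel_measurable lebI" for x
    using f by (simp add: caratheodory_def)
  have cont: "continuous_on UNIV (f t)" if "t \<in> space lebI" for t
    using lipschitz K(2) that
    by (intro lipschitz_on_continuous_on[of "K t"] lipschitz_onI) (auto simp: dist_real_def)
  have um: "u \<in> borel_measurable lebI"
    using u by (rule continuous_imp_measurable_on_sets_lebesgue) simp
  obtain \<phi> where \<phi>: "if n = 1 then \<phi> \<in> borel_measurable lebI \<and> (\<exists>M. AE t in lebI. \<bar>\<phi> t\<bar> \<le> M)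
         else integrable lebI \<phi>" "AE t in lebI. \<forall>x\<in>{-1..1}. \<bar>f t x\<bar> \<le> \<phi> t"
    using f[unfolded caratheodory_def, THEN conjunct2, THEN conjunct2, rule_format, of 1] by auto
  have "integrable lebI \<phi>"
  proof (cases "n = 1")
    case True
    then obtain B where B: "\<phi> \<in> borel_measurable lebI" "AE t in lebI. \<bar>\<phi> t\<bar> \<le> B"
      using \<phi>(1) by auto
    show ?thesis
      by (rule Bochner_Integration.integrable_bound[of lebI "\<lambda>t. B"]) (use B in auto)
  qed (use \<phi>(1) in simp)
  then have f0: "integrable lebI (\<lambda>t. f t 0)"
  proof (rule Bochner_Integration.integrable_bound[OF _ fm])
    have "norm (f t 0) \<le> norm (\<phi> t)" if "\<forall>x\<in>{-1..1}. \<bar>f t x\<bar> \<le> \<phi> t" for t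
      using bspec[OF that, of 0] by auto
    then show "AE t in lebI. norm (f t 0) \<le> norm (\<phi> t)"
      by (rule eventually_mono[OF \<phi>(2)])
  qed
  show ?thesis
  proof (rule Bochner_Integration.integrable_bound[of lebI "\<lambda>t. \<bar>f t 0\<bar> + sup_norm u * K t"])
    show "integrable lebI (\<lambda>t. \<bar>f t 0\<bar> + sup_norm u * K t)"
      using f0 K(1) by auto
    show "(\<lambda>t. f t (u t)) \<in> borel_measurable lebI"
      by (rule borel_measurable_compose_continuous[OF fm cont um])
    have "norm (f t (u t)) \<le> norm (\<bar>f t 0\<bar> + sup_norm u * K t)" if "t \<in> I01" for t
    proof -
      have "\<bar>f t (u t)\<bar> \<le> \<bar>f t 0\<bar> + K t * \<bar>u t\<bar>"
        using lipschitz[OF that, of "u t" 0] by auto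
      also have "K t * \<bar>u t\<bar> \<le> K t * sup_norm u"
        using abs_le_sup_norm[OF u that] K(2)[OF that] by (rule mult_left_mono)
      finally show ?thesis by (simp add: mult.commute)
    qed
    then show "AE t in lebI. norm (f t (u t)) \<le> norm (\<bar>f t 0\<bar> + sup_norm u * K t)"
      by (intro AE_I2) simp
  qed
qed

section \<open>Green's function\<close>

text \<open>
  Needed for \<open>K1\<close> to dominate the integrals whose supremum it is. For each
  integrable \<open>\<sigma>\<close> the solution \<open>\<integral> g t s * \<sigma> s\<close> is continuous in \<open>t\<close>,
  hence bounded on \<open>I01\<close>. Taking \<open>\<sigma> = \<phi> * K\<close> with bounded \<open>\<phi>\<close> gives exactly the weak bounds
  that the uniform boundedness principle turns into a bound on the integrals of \<open>\<bar>g t\<bar> * K\<close>.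
\<close>

lemma bdd_above_integral_abs_green:
  assumes g: "green_function n a \<alpha> \<beta> g"
    and K: "integrable lebI K" "\<And>t. t \<in> I01 \<Longrightarrow> K t \<ge> 0"
  shows "bdd_above ((\<lambda>t. LINT s|lebI. \<bar>g t s\<bar> * K s) ` I01)"
proof -
  have "bdd_above ((\<lambda>t. LINT s|lebI. \<bar>g t s * K s\<bar>) ` I01)"
  proof (rule bdd_above_integral_abs_of_weakly_bounded)
    show "integrable lebI (\<lambda>s. g t s * K s)" if "t \<in> I01" for t
      using g K(1) that by (simp add: green_function_def)
    fix \<phi> :: "real \<Rightarrow> real"
    assume \<phi>: "\<phi> \<in> borel_measurable lebI" "\<exists>B. \<forall>s. \<bar>\<phi> s\<bar> \<le> B"
    then obtain B where B: "\<And>s. \<bar>\<phi> s\<bar> \<le> B" by blast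
    have "integrable lebI (\<lambda>s. \<phi> s * K s)"
      by (rule integrable_bounded_mult[OF K(1) \<phi>(1) B])
    then have "(\<lambda>t. LINT s|lebI. g t s * (\<phi> s * K s)) \<in> C_I (n - 1)"
      using g by (simp add: green_function_def solves_def)
    then have "bdd_above ((\<lambda>t. \<bar>LINT s|lebI. g t s * (\<phi> s * K s)\<bar>) ` I01)"
      by (rule bdd_above_abs_continuous[OF C_I_imp_continuous_on])
    then show "bdd_above ((\<lambda>t. \<bar>LINT s|lebI. g t s * K s * \<phi> s\<bar>) ` I01)"
      by (simp add: mult_ac)
  qed
  moreover have "(LINT s|lebI. \<bar>g t s * K s\<bar>) = (LINT s|lebI. \<bar>g t s\<bar> * K s)" for t
    using K(2) by (intro Bochner_Integration.integral_cong) (auto simp: abs_mult)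
  ultimately show ?thesis by simp
qed

text \<open>
  Both sides solve the same equation, and they have the same boundary values because the
  boundary values of \<open>\<omega> i\<close> form the \<open>i\<close>-th unit vector. Their difference therefore solves the
  homogeneous problem, which has only the trivial solution.
\<close>

lemma green_representation:
  fixes \<alpha> \<beta> :: "'n::finite \<Rightarrow> nat \<Rightarrow> real"
  assumes n: "n \<ge> 1"
    and trivial: "\<And>u. solves n a u (\<lambda>t. 0) \<Longrightarrow> (\<And>i. bc n (\<alpha> i) (\<beta> i) u = 0) \<Longrightarrow>
                     (\<forall>t\<in>I01. u t = 0)"
    and g: "green_function n a \<alpha> \<beta> g"
    and \<omega>: "\<And>i. solves n a (\<omega> i) (\<lambda>t. 0)"
           "\<And>i k. bc n (\<alpha> k) (\<beta> k) (\<omega> i) = (if k = i then 1 else 0)"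
    and \<sigma>: "integrable lebI \<sigma>" and u: "solves n a u \<sigma>" and t: "t \<in> I01"
  shows "u t = (LINT s|lebI. g t s * \<sigma> s) + (\<Sum>i\<in>UNIV. bc n (\<alpha> i) (\<beta> i) u * \<omega> i t)"
proof -
  define v where "v t = (LINT s|lebI. g t s * \<sigma> s)" for t
  define w where "w t = v t + (\<Sum>i\<in>UNIV. bc n (\<alpha> i) (\<beta> i) u * \<omega> i t)" for t
  have v: "solves n a v \<sigma>" "\<And>k. bc n (\<alpha> k) (\<beta> k) v = 0"
    using g \<sigma> by (auto simp: green_function_def v_def[abs_def])
  have w: "solves n a w \<sigma>"
    unfolding w_def[abs_def] by (rule solves_sum[OF n _ v(1) \<omega>(1)]) simp
  have C: "u \<in> C_I (n - 1)" "v \<in> C_I (n - 1)" "w \<in> C_I (n - 1)" "\<And>i. \<omega> i \<in> C_I (n - 1)"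
    using u v w \<omega>(1) by (auto simp: solves_def)
  have bw: "bc n (\<alpha> k) (\<beta> k) w = bc n (\<alpha> k) (\<beta> k) u" for k
    unfolding w_def[abs_def]
    using linear_on_C_I_sum[of "n - 1" "bc n (\<alpha> k) (\<beta> k)" UNIV v \<omega>, OF bc_lincomb _ C(2,4)]
    by (simp add: v(2) \<omega>(2) if_distrib[of "(*) _"] cong: if_cong)
  have "\<forall>t\<in>I01. w t + (- 1) * u t = 0"
  proof (rule trivial)
    show "solves n a (\<lambda>t. w t + (- 1) * u t) (\<lambda>t. 0)"
      using solves_lincomb[OF n w u, of "- 1"] by simp
    show "bc n (\<alpha> k) (\<beta> k) (\<lambda>t. w t + (- 1) * u t) = 0" for k
      using bc_lincomb[OF C(3,1), of "\<alpha> k" "\<beta> k" "- 1"] bw by simp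
  qed
  then show ?thesis using t by (simp add: w_def v_def)
qed

section \<open>Distance between the solutions of the local and the nonlocal problem\<close>

theorem theorem5p1:
  fixes n :: nat
    and a :: "nat \<Rightarrow> real \<Rightarrow> real"
    and \<alpha> \<beta> :: "'n::finite \<Rightarrow> nat \<Rightarrow> real"
    and C :: "'n \<Rightarrow> (real \<Rightarrow> real) \<Rightarrow> real"
    and \<delta> :: "'n \<Rightarrow> real"
    and g :: "real \<Rightarrow> real \<Rightarrow> real"
    and \<omega> Cg :: "'n \<Rightarrow> real \<Rightarrow> real"
    and A b :: "real ^ 'n ^ 'n"
    and f :: "real \<Rightarrow> real \<Rightarrow> real"
    and K :: "real \<Rightarrow> real"
    and K1 :: real
    and K2 K3 :: "'n \<Rightarrow> 'n \<Rightarrow> real"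
    and u\<^sub>A u\<^sub>B :: "real \<Rightarrow> real"
  assumes n: "n = CARD('n)"
    and a: "\<And>k. k \<in> {1..n} \<Longrightarrow> integrable lebI (a k)"
    and C: "\<And>i. cont_linear_functional (n - 1) (C i)"
    and trivial: "\<And>u. solves n a u (\<lambda>t. 0) \<Longrightarrow> (\<And>i. bc n (\<alpha> i) (\<beta> i) u = 0) \<Longrightarrow>
                     (\<forall>t\<in>I01. u t = 0)"
    and g: "green_function n a \<alpha> \<beta> g"
    and \<omega>: "\<And>i. solves n a (\<omega> i) (\<lambda>t. 0)"
           "\<And>i k. bc n (\<alpha> k) (\<beta> k) (\<omega> i) = (if k = i then 1 else 0)"
    and A: "A = (\<chi> i j. \<delta> j * C i (\<omega> j))"
    and det: "det (mat 1 - A) \<noteq> 0"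
    and b: "b = matrix_inv (mat 1 - A)"
    and Cg: "\<And>j. applied_to_green (C j) g (Cg j)"
    and f: "caratheodory n f"
    and K: "integrable lebI K" "\<And>t. t \<in> I01 \<Longrightarrow> K t \<ge> 0"
    and lipschitz: "\<And>t x y. t \<in> I01 \<Longrightarrow> \<bar>f t x - f t y\<bar> \<le> K t * \<bar>x - y\<bar>"
    and K1: "K1 = (SUP t\<in>I01. LINT s|lebI. \<bar>g t s\<bar> * K s)" "K1 < 1"
    and u\<^sub>A: "solves n a u\<^sub>A (\<lambda>t. f t (u\<^sub>A t))" "\<And>i. bc n (\<alpha> i) (\<beta> i) u\<^sub>A = \<delta> i * C i u\<^sub>A"
    and u\<^sub>B: "solves n a u\<^sub>B (\<lambda>t. f t (u\<^sub>B t))" "\<And>i. bc n (\<alpha> i) (\<beta> i) u\<^sub>B = 0"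
    and K2: "\<And>i j. K2 i j = (SUP t\<in>I01. \<bar>\<omega> i t\<bar>) * (LINT s|lebI. \<bar>Cg j s\<bar> * K s)"
    and K3: "\<And>i j. K3 i j = (SUP t\<in>I01. \<bar>\<omega> i t\<bar>) * (LINT s|lebI. \<bar>Cg j s * f s 0\<bar>)"
  shows "sup_norm (\<lambda>t. u\<^sub>B t - u\<^sub>A t) \<le>
           1 / (1 - K1) *
             ((\<Sum>i\<in>UNIV. \<Sum>j\<in>UNIV. \<bar>\<delta> i * b $ i $ j\<bar> * K2 i j * sup_norm u\<^sub>A)
              + (\<Sum>i\<in>UNIV. \<Sum>j\<in>UNIV. \<bar>\<delta> i * b $ i $ j\<bar> * K3 i j))"
proof -
  have n1: "n \<ge> 1" using n by (simp add: Suc_le_eq)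
  define \<sigma>A \<sigma>B where "\<sigma>A t = f t (u\<^sub>A t)" and "\<sigma>B t = f t (u\<^sub>B t)" for t
  have CI: "u\<^sub>A \<in> C_I (n - 1)" "u\<^sub>B \<in> C_I (n - 1)" "\<And>i. \<omega> i \<in> C_I (n - 1)"
    using u\<^sub>A(1) u\<^sub>B(1) \<omega>(1) by (auto simp: solves_def)
  note cont = CI[THEN C_I_imp_continuous_on]
  have f_int: "integrable lebI (\<lambda>t. f t (u t))" if "continuous_on I01 u" for u
    by (rule integrable_compose_caratheodory[OF f K lipschitz that])
  have \<sigma>A: "integrable lebI \<sigma>A" and \<sigma>B: "integrable lebI \<sigma>B"
    and f0: "integrable lebI (\<lambda>t. f t 0)"
    using f_int[OF cont(1)] f_int[OF cont(2)] f_int[of "\<lambda>t. 0"]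
    by (simp_all add: \<sigma>A_def[abs_def] \<sigma>B_def[abs_def])
  have rep: "u t = (LINT s|lebI. g t s * \<sigma> s) + (\<Sum>i\<in>UNIV. bc n (\<alpha> i) (\<beta> i) u * \<omega> i t)"
    if "integrable lebI \<sigma>" "solves n a u \<sigma>" "t \<in> I01" for u \<sigma> t
    by (rule green_representation[OF n1 _ g \<omega> that]) (rule trivial)
  define v where "v t = (LINT s|lebI. g t s * \<sigma>A s)" for t
  define c where "c i = C i u\<^sub>A" for i
  define w where "w j = (LINT s|lebI. Cg j s * \<sigma>A s)" for j
  have vC: "v \<in> C_I (n - 1)"
    using g \<sigma>A by (auto simp: green_function_def solves_def v_def[abs_def])
  have uA_rep: "u\<^sub>A t = v t + (\<Sum>i\<in>UNIV. (\<delta> i * c i) * \<omega> i t)" if "t \<in> I01" for t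
    using rep[OF \<sigma>A _ that, of u\<^sub>A] u\<^sub>A by (simp add: v_def c_def \<sigma>A_def[abs_def])
  have uB_rep: "u\<^sub>B t = (LINT s|lebI. g t s * \<sigma>B s)" if "t \<in> I01" for t
    using rep[OF \<sigma>B _ that, of u\<^sub>B] u\<^sub>B by (simp add: \<sigma>B_def[abs_def])

  \<comment> \<open>Applying each \<open>C j\<close> to the representation of \<open>u\<^sub>A\<close> closes the system for the unknown values
    \<open>c\<close>: it reads \<open>c = w + A c\<close>.\<close>
  have c_eq: "c j = w j + (\<Sum>i\<in>UNIV. A $ j $ i * c i)" for j
  proof -
    have "c j = C j (\<lambda>t. v t + (\<Sum>i\<in>UNIV. (\<delta> i * c i) * \<omega> i t))"
      unfolding c_def[of j]
      by (rule cont_linear_functional_cong[OF C CI(1) C_I_sum[OF _ vC CI(3)]]) (simp_all add: uA_rep)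
    also have "\<dots> = C j v + (\<Sum>i\<in>UNIV. (\<delta> i * c i) * C j (\<omega> i))"
      by (rule linear_on_C_I_sum[OF cont_linear_functional_lincomb[OF C] _ vC CI(3)]) simp_all
    also have "C j v = w j"
      using Cg[of j] \<sigma>A by (simp add: applied_to_green_def v_def[abs_def] w_def)
    finally show ?thesis by (simp add: A mult_ac)
  qed
  have "(mat 1 - A) *v (\<chi> j. c j) = (\<chi> j. w j)"
  proof -
    have "(\<Sum>i\<in>UNIV. A $ j $ i * c i) = c j - w j" for j
      using c_eq[of j] by linarith
    then have "A *v (\<chi> j. c j) = (\<chi> j. c j - w j)"
      by (simp add: matrix_vector_mult_def vec_eq_iff)
    then show ?thesis
      by (simp add: matrix_vector_mult_diff_rdistrib vec_eq_iff)
  qed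
  moreover have "b ** (mat 1 - A) = mat 1"
  proof -
    have "invertible (mat 1 - A)" using det by (simp add: invertible_det_nz)
    then show ?thesis
      unfolding b matrix_inv_def invertible_def by (rule someI2_ex) simp
  qed
  ultimately have "(\<chi> j. c j) = b *v (\<chi> j. w j)"
    by (metis matrix_vector_mul_assoc matrix_vector_mul_lid)
  then have c_sol: "c i = (\<Sum>j\<in>UNIV. b $ i $ j * w j)" for i
    by (simp add: vec_eq_iff matrix_vector_mult_def)

  define p where "p j = (LINT s|lebI. \<bar>Cg j s\<bar> * K s)" for j
  define q where "q j = (LINT s|lebI. \<bar>Cg j s * f s 0\<bar>)" for j
  have w_le: "\<bar>w j\<bar> \<le> p j * sup_norm u\<^sub>A + q j" for j
  proof -
    obtain M where Cgm: "Cg j \<in> borel_measurable lebI" and M: "\<And>s. s \<in> I01 \<Longrightarrow> \<bar>Cg j s\<bar> \<le> M"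
      using Cg[of j] unfolding applied_to_green_def by metis
    have i: "integrable lebI (\<lambda>s. Cg j s * h s)" if "integrable lebI h" for h
      by (rule integrable_bounded_mult[OF that Cgm, of M]) (simp add: M)
    have iK: "integrable lebI (\<lambda>s. \<bar>Cg j s\<bar> * K s)"
      by (rule integrable_bounded_mult[OF K(1), of _ M]) (use Cgm M in auto)
    have "\<bar>w j\<bar> \<le> (LINT s|lebI. \<bar>Cg j s\<bar> * K s * sup_norm u\<^sub>A + \<bar>Cg j s * f s 0\<bar>)"
      unfolding w_def
    proof (rule integral_abs_bound_integral[OF i[OF \<sigma>A]])
      show "integrable lebI (\<lambda>s. \<bar>Cg j s\<bar> * K s * sup_norm u\<^sub>A + \<bar>Cg j s * f s 0\<bar>)"
        using iK i[OF f0] by auto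
      fix s assume "s \<in> space lebI"
      then have s: "s \<in> I01" by simp
      have "\<bar>\<sigma>A s\<bar> \<le> K s * \<bar>u\<^sub>A s\<bar> + \<bar>f s 0\<bar>"
        using lipschitz[OF s, of "u\<^sub>A s" 0] by (simp add: \<sigma>A_def)
      also have "K s * \<bar>u\<^sub>A s\<bar> \<le> K s * sup_norm u\<^sub>A"
        by (rule mult_left_mono[OF abs_le_sup_norm[OF cont(1) s] K(2)[OF s]])
      finally have "\<bar>Cg j s\<bar> * \<bar>\<sigma>A s\<bar> \<le> \<bar>Cg j s\<bar> * (K s * sup_norm u\<^sub>A + \<bar>f s 0\<bar>)"
        by (intro mult_left_mono) auto
      then show "\<bar>Cg j s * \<sigma>A s\<bar> \<le> \<bar>Cg j s\<bar> * K s * sup_norm u\<^sub>A + \<bar>Cg j s * f s 0\<bar>"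
        by (simp add: abs_mult distrib_left mult.assoc)
    qed
    also have "\<dots> = p j * sup_norm u\<^sub>A + q j"
      using iK i[OF f0] by (simp add: p_def q_def)
    finally show ?thesis .
  qed

  define S where "S = sup_norm (\<lambda>t. u\<^sub>B t - u\<^sub>A t)"
  define R where "R = (\<Sum>i\<in>UNIV. \<Sum>j\<in>UNIV. \<bar>\<delta> i * b $ i $ j\<bar> * (sup_norm (\<omega> i) * (p j * sup_norm u\<^sub>A + q j)))"
  have contD: "continuous_on I01 (\<lambda>t. u\<^sub>B t - u\<^sub>A t)"
    by (rule continuous_on_diff[OF cont(2,1)])
  have S0: "S \<ge> 0"
    using abs_le_sup_norm[OF contD, of 0] by (simp add: S_def)
  \<comment> \<open>The nonlinear part contracts: it contributes at most \<open>K1\<close> times the quantity to be bounded.\<close>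
  have green_part: "\<bar>LINT s|lebI. g t s * (\<sigma>B s - \<sigma>A s)\<bar> \<le> K1 * S" if t: "t \<in> I01" for t
  proof -
    have gi: "integrable lebI (\<lambda>s. g t s * h s)" if "integrable lebI h" for h
      using g that t by (simp add: green_function_def)
    have "integrable lebI (\<lambda>s. \<bar>g t s * K s\<bar>)" using gi[OF K(1)] by auto
    then have iK: "integrable lebI (\<lambda>s. \<bar>g t s\<bar> * K s)"
      by (rule Bochner_Integration.integrable_cong[THEN iffD1, rotated -1]) (use K(2) in \<open>auto simp: abs_mult\<close>)
    have "\<bar>LINT s|lebI. g t s * (\<sigma>B s - \<sigma>A s)\<bar> \<le> (LINT s|lebI. \<bar>g t s\<bar> * K s * S)"
    proof (rule integral_abs_bound_integral)
      show "integrable lebI (\<lambda>s. g t s * (\<sigma>B s - \<sigma>A s))"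
        using gi \<sigma>A \<sigma>B by simp
      show "integrable lebI (\<lambda>s. \<bar>g t s\<bar> * K s * S)" using iK by auto
      fix s assume "s \<in> space lebI"
      then have s: "s \<in> I01" by simp
      have "\<bar>\<sigma>B s - \<sigma>A s\<bar> \<le> K s * \<bar>u\<^sub>B s - u\<^sub>A s\<bar>"
        using lipschitz[OF s] by (simp add: \<sigma>A_def \<sigma>B_def)
      also have "\<dots> \<le> K s * S"
        unfolding S_def by (rule mult_left_mono[OF abs_le_sup_norm[OF contD s] K(2)[OF s]])
      finally have "\<bar>g t s\<bar> * \<bar>\<sigma>B s - \<sigma>A s\<bar> \<le> \<bar>g t s\<bar> * (K s * S)"
        by (rule mult_left_mono) simp
      then show "\<bar>g t s * (\<sigma>B s - \<sigma>A s)\<bar> \<le> \<bar>g t s\<bar> * K s * S"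
        by (simp add: abs_mult mult.assoc)
    qed
    also have "\<dots> = (LINT s|lebI. \<bar>g t s\<bar> * K s) * S" by simp
    also have "\<dots> \<le> K1 * S"
      unfolding K1(1)
      by (rule mult_right_mono[OF cSUP_upper[OF t bdd_above_integral_abs_green[OF g K]] S0])
    finally show ?thesis .
  qed
  \<comment> \<open>The nonlocal boundary conditions contribute a term that involves \<open>u\<^sub>A\<close> alone.\<close>
  have bc_part: "\<bar>\<Sum>i\<in>UNIV. \<delta> i * c i * \<omega> i t\<bar> \<le> R" if t: "t \<in> I01" for t
  proof -
    have "\<bar>\<delta> i * c i * \<omega> i t\<bar>
        \<le> (\<Sum>j\<in>UNIV. \<bar>\<delta> i * b $ i $ j\<bar> * (sup_norm (\<omega> i) * (p j * sup_norm u\<^sub>A + q j)))" for i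
    proof -
      have "\<delta> i * c i * \<omega> i t = (\<Sum>j\<in>UNIV. (\<delta> i * b $ i $ j) * (\<omega> i t * w j))"
        by (simp add: c_sol sum_distrib_left sum_distrib_right mult_ac)
      also have "\<bar>\<dots>\<bar> \<le> (\<Sum>j\<in>UNIV. \<bar>\<delta> i * b $ i $ j\<bar> * (\<bar>\<omega> i t\<bar> * \<bar>w j\<bar>))"
        by (rule order.trans[OF sum_abs]) (simp add: abs_mult)
      also have "\<dots> \<le> (\<Sum>j\<in>UNIV. \<bar>\<delta> i * b $ i $ j\<bar> * (sup_norm (\<omega> i) * (p j * sup_norm u\<^sub>A + q j)))"
        by (rule sum_mono, rule mult_left_mono, rule mult_mono)
          (use abs_le_sup_norm[OF cont(3) t] w_le in \<open>auto intro: order.trans[OF abs_ge_zero]\<close>)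
      finally show ?thesis .
    qed
    then show ?thesis unfolding R_def by (intro order.trans[OF sum_abs] sum_mono)
  qed
  have "\<bar>u\<^sub>B t - u\<^sub>A t\<bar> \<le> K1 * S + R" if t: "t \<in> I01" for t
  proof -
    have "integrable lebI (\<lambda>s. g t s * \<sigma>B s)" "integrable lebI (\<lambda>s. g t s * \<sigma>A s)"
      using g t \<sigma>A \<sigma>B by (simp_all add: green_function_def)
    then have "u\<^sub>B t - u\<^sub>A t = (LINT s|lebI. g t s * (\<sigma>B s - \<sigma>A s)) - (\<Sum>i\<in>UNIV. \<delta> i * c i * \<omega> i t)"
      by (simp add: uA_rep[OF t] uB_rep[OF t] v_def right_diff_distrib)
    then show ?thesis using green_part[OF t] bc_part[OF t] by linarith
  qed
  then have "S \<le> K1 * S + R"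
    unfolding S_def sup_norm_def by (intro cSUP_least) auto
  then have "(1 - K1) * S \<le> R" by (simp add: algebra_simps)
  then have "S \<le> 1 / (1 - K1) * R"
    using K1(2) by (simp add: pos_le_divide_eq mult.commute)
  also have "R = (\<Sum>i\<in>UNIV. \<Sum>j\<in>UNIV. \<bar>\<delta> i * b $ i $ j\<bar> * K2 i j * sup_norm u\<^sub>A)
              + (\<Sum>i\<in>UNIV. \<Sum>j\<in>UNIV. \<bar>\<delta> i * b $ i $ j\<bar> * K3 i j)"
    unfolding R_def
    by (simp add: K2 K3 p_def q_def sup_norm_def[of "\<omega> _"] sum.distrib[symmetric] distrib_left mult_ac)
  finally show ?thesis by (simp add: S_def)
qed

end
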